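(* Let $\mathcal{A}\in\mathbb{C}^{n_1\times n_2\times n_3}$. Suppose $\mathcal{A}^H$ has the C-QDR decomposition $\mathcal{A}^H=\mathcal{Q}*_c\mathcal{D}*_c\mathcal{R}$. Then $$\mathcal{A}^\dagger=\mathcal{Q}*_c(\mathcal{R}*_c\mathcal{A}*_c\mathcal{Q})^{-1}*_c\mathcal{R}.$$
   Context: For a third-order tensor $\mathcal{A}\in\mathbb{C}^{n_1\times n_2\times n_3}$, $\mathcal{A}^{(i)}=\mathcal{A}(:,:,i)\in\mathbb{C}^{n_1\times n_2}$ denotes its $i$-th frontal slice. Let $\mathbf{C}_{n_3}$ be the $n_3\times n_3$ orthogonal DCT matrix, with entries $(\mathbf{C}_{n_3})_{jk}=\sqrt{(2-\delta_{j1})/n_3}\,\cos\big(\tfrac{(j-1)(2k-1)\pi}{2n_3}\big)$; let $\mathbf{W}$ be the diagonal matrix whose diagonal is the first column of $\mathbf{C}_{n_3}$; let $\mathbf{Z}$ be the $n_3\times n_3$ matrix with ones on the first superdiagonal and zeros elsewhere; and put $\mathbf{M}=\mathbf{W}^{-1}\mathbf{C}_{n_3}(\mathbf{I}+\mathbf{Z})$, an invertible matrix. Define the linear bijection $L$ on tensors with third dimension $n_3$ by $L(\mathcal{A})_{ijk}=\sum_{l=1}^{n_3}\mathbf{M}_{kl}\mathcal{A}_{ijl}$. The C-product of $\mathcal{A}\in\mathbb{C}^{n_1\times n_2\times n_3}$ and $\mathcal{B}\in\mathbb{C}^{n_2\times l\times n_3}$ is the tensor $\mathcal{A}*_c\mathcal{B}\in\mathbb{C}^{n_1\times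 l\times n_3}$ determined by $L(\mathcal{A}*_c\mathcal{B})^{(i)}=L(\mathcal{A})^{(i)}L(\mathcal{B})^{(i)}$, $i=1,\dots,n_3$. The conjugate transpose $\mathcal{A}^H$ is determined by $L(\mathcal{A}^H)^{(i)}=(L(\mathcal{A})^{(i)})^H$ for all $i$. The identity tensor $\mathcal{I}\in\mathbb{C}^{n\times n\times n_3}$ is determined by $L(\mathcal{I})^{(i)}=\mathbf{I}_n$ for all $i$. The inverse $\mathcal{B}^{-1}$ of $\mathcal{B}\in\mathbb{C}^{n\times n\times n_3}$ is the tensor with $\mathcal{B}*_c\mathcal{B}^{-1}=\mathcal{B}^{-1}*_c\mathcal{B}=\mathcal{I}$; a formula containing an inverse includes the assertion that the inverse exists. A tensor is F-diagonal (F-upper) if all its frontal slices are diagonal (upper triangular) matrices. A C-QDR decomposition of $\mathcal{B}\in\mathbb{C}^{m_1\times m_2\times n_3}$ is a factorization $\mathcal{B}=\mathcal{Q}*_c\mathcal{D}*_c\mathcal{R}$, for some $r$, where $\mathcal{Q}\in\mathbb{C}^{m_1\times r\times n_3}$ with each $L(\mathcal{Q})^{(i)}\in\mathbb{C}^{m_1\times r}$ of rank $r$, $\mathcal{D}\in\mathbb{C}^{r\times r\times n_3}$ is an invertible F-diagonal tensor, and $\mathcal{R}\in\mathbb{C}^{r\times m_2\times n_3}$ is an F-upper tensor with each $L(\mathcal{R})^{(i)}\in\mathbb{C}^{r\times m_2}$ of rank $r$, $i=1,\dots,n_3$. The Moore-Penrose inverse $\mathcal{A}^\dagger$ is the (unique)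 tensor $\mathcal{X}\in\mathbb{C}^{n_2\times n_1\times n_3}$ with $\mathcal{A}*_c\mathcal{X}*_c\mathcal{A}=\mathcal{A}$, $\mathcal{X}*_c\mathcal{A}*_c\mathcal{X}=\mathcal{X}$, $(\mathcal{A}*_c\mathcal{X})^H=\mathcal{A}*_c\mathcal{X}$, $(\mathcal{X}*_c\mathcal{A})^H=\mathcal{X}*_c\mathcal{A}$. *)

theory Defs
  imports
    Complex_Main
    "Jordan_Normal_Form.Matrix"
    "Jordan_Normal_Form.Gauss_Jordan_Elimination"
    "Jordan_Normal_Form.Schur_Decomposition"
    "Jordan_Normal_Form.DL_Rank"
begin

text \<open>
  A complex third-order tensor is the vector of its frontal slices, so that \<open>A $ k\<close> is the
  \<open>k\<close>-th frontal slice and \<open>A $ k $$ (i, j)\<close> the entry with indices \<open>i, j, k\<close>. All indices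
  start at 0. As vectors and matrices of the library are extensional, equality of two elements
  of a tensor carrier is entrywise equality.
\<close>

type_synonym tensor = "complex mat vec"

definition carrier_tensor :: "nat \<Rightarrow> nat \<Rightarrow> nat \<Rightarrow> tensor set" where
  "carrier_tensor n1 n2 n3 = {A. dim_vec A = n3 \<and> (\<forall>k<n3. A $ k \<in> carrier_mat n1 n2)}"

text \<open>
  These are the dimensions of an element of \<open>carrier_tensor n1 n2 n3\<close> for \<open>n3 > 0\<close>; the first
  two mean nothing for \<open>n3 = 0\<close>.
\<close>

definition tensor_dim1 :: "tensor \<Rightarrow> nat" where
  "tensor_dim1 A = dim_row (A $ 0)"

definition tensor_dim2 :: "tensor \<Rightarrow> nat" where
  "tensor_dim2 A = dim_col (A $ 0)"

definition tensor_dim3 :: "tensor \<Rightarrow> nat" where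
  "tensor_dim3 A = dim_vec A"

text \<open>
  The orthogonal DCT matrix. With indices starting at 0, the factor \<open>(j - 1) (2 k - 1)\<close> of the
  usual formula becomes \<open>j (2 k + 1)\<close>, and the exceptional row is row 0.
\<close>

definition dct_mat :: "nat \<Rightarrow> complex mat" where
  "dct_mat n = mat n n (\<lambda>(j, k). complex_of_real
     (sqrt ((2 - (if j = 0 then 1 else 0)) / real n)
       * cos (real j * (2 * real k + 1) * pi / (2 * real n))))"

definition dct_W :: "nat \<Rightarrow> complex mat" where
  "dct_W n = mat_diag n (\<lambda>j. dct_mat n $$ (j, 0))"

definition superdiag_mat :: "nat \<Rightarrow> complex mat" where
  "superdiag_mat n = mat n n (\<lambda>(i, j). if j = Suc i then 1 else 0)"

definition c_mat :: "nat \<Rightarrow> complex mat" where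
  "c_mat n = the (mat_inverse (dct_W n)) * dct_mat n * (1\<^sub>m n + superdiag_mat n)"

text \<open>
  The linear bijection \<open>L\<close>. Since \<open>c_mat n\<close> is invertible for \<open>n > 0\<close>, a tensor is determined
  by its transform; the definite descriptions below rest on this.
\<close>

definition c_transform :: "tensor \<Rightarrow> tensor" where
  "c_transform A = vec (tensor_dim3 A) (\<lambda>k. mat (tensor_dim1 A) (tensor_dim2 A)
     (\<lambda>(i, j). \<Sum>l<tensor_dim3 A. c_mat (tensor_dim3 A) $$ (k, l) * A $ l $$ (i, j)))"

definition c_prod :: "tensor \<Rightarrow> tensor \<Rightarrow> tensor" (infixl \<open>*\<^sub>c\<close> 70) where
  "A *\<^sub>c B = (THE C. C \<in> carrier_tensor (tensor_dim1 A) (tensor_dim2 B) (tensor_dim3 A) \<and>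
     (\<forall>i<tensor_dim3 A. c_transform C $ i = c_transform A $ i * c_transform B $ i))"

definition c_adjoint :: "tensor \<Rightarrow> tensor" where
  "c_adjoint A = (THE C. C \<in> carrier_tensor (tensor_dim2 A) (tensor_dim1 A) (tensor_dim3 A) \<and>
     (\<forall>i<tensor_dim3 A. c_transform C $ i = mat_adjoint (c_transform A $ i)))"

definition c_identity :: "nat \<Rightarrow> nat \<Rightarrow> tensor" where
  "c_identity n n3 = (THE C. C \<in> carrier_tensor n n n3 \<and>
     (\<forall>i<n3. c_transform C $ i = 1\<^sub>m n))"

definition is_c_inverse :: "tensor \<Rightarrow> tensor \<Rightarrow> bool" where
  "is_c_inverse B X \<longleftrightarrow> (\<exists>n n3. B \<in> carrier_tensor n n n3 \<and> X \<in> carrier_tensor n n n3 \<and>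
     B *\<^sub>c X = c_identity n n3 \<and> X *\<^sub>c B = c_identity n n3)"

definition c_invertible :: "tensor \<Rightarrow> bool" where
  "c_invertible B \<longleftrightarrow> (\<exists>X. is_c_inverse B X)"

definition c_inverse :: "tensor \<Rightarrow> tensor" where
  "c_inverse B = (THE X. is_c_inverse B X)"

definition F_diagonal :: "tensor \<Rightarrow> bool" where
  "F_diagonal A \<longleftrightarrow> (\<forall>k<tensor_dim3 A. diagonal_mat (A $ k))"

text \<open>
  The library predicate \<open>upper_triangular\<close> is not used for the slices, because on a matrix with
  more rows than columns it refers to entries outside the matrix.
\<close>

definition F_upper :: "tensor \<Rightarrow> bool" where
  "F_upper A \<longleftrightarrow> (\<forall>k<tensor_dim3 A. \<forall>i<dim_row (A $ k). \<forall>j<dim_col (A $ k).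
     j < i \<longrightarrow> A $ k $$ (i, j) = 0)"

text \<open>
  \<open>is_C_QDR m1 m2 n3 r B Q D R\<close>: the \<open>m1 \<times> m2 \<times> n3\<close> tensor \<open>B\<close> has the C-QDR decomposition
  \<open>B = Q *\<^sub>c D *\<^sub>c R\<close> with inner dimension \<open>r\<close>. The first argument of \<open>vec_space.rank\<close> is the
  number of rows of the matrix.
\<close>

definition is_C_QDR ::
  "nat \<Rightarrow> nat \<Rightarrow> nat \<Rightarrow> nat \<Rightarrow> tensor \<Rightarrow> tensor \<Rightarrow> tensor \<Rightarrow> tensor \<Rightarrow> bool" where
  "is_C_QDR m1 m2 n3 r B Q D R \<longleftrightarrow>
     B \<in> carrier_tensor m1 m2 n3 \<and>
     Q \<in> carrier_tensor m1 r n3 \<and> (\<forall>i<n3. vec_space.rank m1 (c_transform Q $ i) = r) \<and>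
     D \<in> carrier_tensor r r n3 \<and> F_diagonal D \<and> c_invertible D \<and>
     R \<in> carrier_tensor r m2 n3 \<and> F_upper R \<and>
       (\<forall>i<n3. vec_space.rank r (c_transform R $ i) = r) \<and>
     B = Q *\<^sub>c D *\<^sub>c R"

definition is_c_moore_penrose :: "tensor \<Rightarrow> tensor \<Rightarrow> bool" where
  "is_c_moore_penrose A X \<longleftrightarrow>
     X \<in> carrier_tensor (tensor_dim2 A) (tensor_dim1 A) (tensor_dim3 A) \<and>
     A *\<^sub>c X *\<^sub>c A = A \<and> X *\<^sub>c A *\<^sub>c X = X \<and>
     c_adjoint (A *\<^sub>c X) = A *\<^sub>c X \<and> c_adjoint (X *\<^sub>c A) = X *\<^sub>c A"

definition c_moore_penrose :: "tensor \<Rightarrow> tensor" where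
  "c_moore_penrose A = (THE X. is_c_moore_penrose A X)"

end

theory Submission
  imports Defs
begin

text \<open>
  The transform \<open>L\<close> turns the C-product, the conjugate transpose, the identity and hence also
  inverses and Moore-Penrose inverses of tensors into the corresponding operations on each
  transformed slice. This needs that \<open>L\<close> is a bijection (\<open>tensor_of_transformed_slices\<close>), which
  comes down to the invertibility of \<open>c_mat n\<close>: the DCT matrix is orthogonal
  (\<open>dct_mat_orthogonal\<close>), its first column has no zero entry, and \<open>I + Z\<close> is unitriangular.

  On one slice the claim is a fact about complex matrices (\<open>moore_penrose_mat_of_factorization\<close>).
  If \<open>A\<^sup>H = Q D R\<close> with \<open>Q\<close> of full column rank, \<open>R\<close> of full row rank and \<open>D\<close> invertible, then
  \<open>A = R\<^sup>H D\<^sup>H Q\<^sup>H\<close>, and therefore \<open>R A Q = (R R\<^sup>H) D\<^sup>H (Q\<^sup>H Q)\<close>. Both Gram matrices are invertible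
  by the rank hypotheses, so \<open>R A Q\<close> has an inverse \<open>Y\<close>, and \<open>X = Q Y R\<close> satisfies
  \<open>A X = R\<^sup>H (R R\<^sup>H)\<^sup>-\<^sup>1 R\<close> and \<open>X A = Q (Q\<^sup>H Q)\<^sup>-\<^sup>1 Q\<^sup>H\<close>. These are the orthogonal projections onto the
  ranges of \<open>A\<close> and \<open>A\<^sup>H\<close>, which is what the four Moore-Penrose equations ask for. Since
  the Moore-Penrose inverse of a matrix is unique (\<open>moore_penrose_mat_unique\<close>), so is that of
  the tensor.
\<close>

section \<open>The transform matrix is invertible\<close>

text \<open>
  Multiplied by \<open>2 sin x\<close>, each cosine becomes a difference of sines and the sum telescopes.
\<close>

lemma sum_cos_odd_multiples:
  fixes x :: real
  shows "2 * sin x * (\<Sum>k<n. cos ((2 * real k + 1) * x)) = sin (2 * real n * x)"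
proof (induction n)
  case (Suc n)
  have "sin (2 * real (Suc n) * x) - sin (2 * real n * x)
      = 2 * sin x * cos ((2 * real n + 1) * x)"
    by (simp add: sin_diff_sin algebra_simps add_divide_distrib)
  with Suc show ?case
    by (simp add: algebra_simps)
qed simp

text \<open>
  With \<open>x = m \<pi> / (2 n)\<close> the telescoped sum is \<open>sin (m \<pi>) = 0\<close>. The bound on \<open>m\<close> keeps \<open>x\<close> strictly
  between \<open>-\<pi>\<close> and \<open>\<pi>\<close>, so that \<open>sin x\<close> can be cancelled unless \<open>m = 0\<close>.
\<close>

lemma sum_cos_dct_nodes:
  fixes m :: int
  assumes "0 < n" and "\<bar>m\<bar> < 2 * int n"
  shows "(\<Sum>k<n. cos (real_of_int m * (2 * real k + 1) * pi / (2 * real n)))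
    = (if m = 0 then real n else 0)"
proof (cases "m = 0")
  case False
  define x where "x = real_of_int m * pi / (2 * real n)"
  have "\<bar>real_of_int m\<bar> < 2 * real n"
    using assms(2) by linarith
  then have "\<bar>x\<bar> < pi"
    using assms(1) by (simp add: x_def abs_mult field_simps)
  moreover have "x \<noteq> 0"
    using False assms(1) by (simp add: x_def)
  ultimately have "sin x \<noteq> 0"
    using sin_eq_0_pi[of x] by (auto simp: abs_less_iff minus_less_iff)
  moreover have "2 * real n * x = real_of_int m * pi"
    using assms(1) by (simp add: x_def)
  then have "sin (2 * real n * x) = 0"
    unfolding sin_zero_iff_int2 by blast
  ultimately have "(\<Sum>k<n. cos ((2 * real k + 1) * x)) = 0"
    using sum_cos_odd_multiples[of x n] by simp
  moreover have "real_of_int m * (2 * real k + 1) * pi / (2 * real n) = (2 * real k + 1) * x" for k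
    by (simp add: x_def)
  ultimately show ?thesis
    using False by simp
qed simp

lemma dct_mat_carrier [simp]: "dct_mat n \<in> carrier_mat n n"
  by (simp add: dct_mat_def)

text \<open>
  The product of the cosines in rows \<open>i\<close> and \<open>j\<close> splits into the frequencies \<open>i - j\<close> and \<open>i + j\<close>,
  both of which lie in the range of the previous lemma. Both vanish together exactly for
  \<open>i = j = 0\<close>, which is why row 0 carries a different normalisation.
\<close>

lemma dct_mat_orthogonal:
  assumes "0 < n"
  shows "dct_mat n * transpose_mat (dct_mat n) = 1\<^sub>m n"
proof (rule eq_matI)
  fix i j assume "i < dim_row (1\<^sub>m n :: complex mat)" "j < dim_col (1\<^sub>m n :: complex mat)"
  then have ij: "i < n" "j < n" by auto
  define s where "s i = sqrt ((2 - (if i = 0 then 1 else 0)) / real n)" for i :: nat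
  define S where "S m = (\<Sum>k<n. cos (real_of_int m * (2 * real k + 1) * pi / (2 * real n)))"
    for m :: int
  have S: "S m = (if m = 0 then real n else 0)" if "\<bar>m\<bar> < 2 * int n" for m
    unfolding S_def using sum_cos_dct_nodes[OF assms that] .
  have prod: "cos (real i * (2 * real k + 1) * pi / (2 * real n))
      * cos (real j * (2 * real k + 1) * pi / (2 * real n))
    = (cos (real_of_int (int i - int j) * (2 * real k + 1) * pi / (2 * real n))
      + cos (real_of_int (int i + int j) * (2 * real k + 1) * pi / (2 * real n))) / 2" for k
    by (simp add: cos_times_cos algebra_simps diff_divide_distrib add_divide_distrib)
  have "(\<Sum>k<n. s i * cos (real i * (2 * real k + 1) * pi / (2 * real n))
      * (s j * cos (real j * (2 * real k + 1) * pi / (2 * real n))))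
    = s i * s j * (\<Sum>k<n. cos (real i * (2 * real k + 1) * pi / (2 * real n))
      * cos (real j * (2 * real k + 1) * pi / (2 * real n)))"
    by (simp add: sum_distrib_left algebra_simps)
  also have "\<dots> = s i * s j * ((S (int i - int j) + S (int i + int j)) / 2)"
    by (simp only: prod S_def sum.distrib sum_divide_distrib[symmetric])
  also have "\<dots> = (if i = j then 1 else 0)"
    using ij assms by (auto simp: S s_def)
  finally have "complex_of_real (\<Sum>k<n. s i * cos (real i * (2 * real k + 1) * pi / (2 * real n))
      * (s j * cos (real j * (2 * real k + 1) * pi / (2 * real n)))) = (if i = j then 1 else 0)"
    by simp
  then show "(dct_mat n * transpose_mat (dct_mat n)) $$ (i, j) = 1\<^sub>m n $$ (i, j)"
    using ij by (simp add: dct_mat_def scalar_prod_def s_def lessThan_atLeast0)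
qed (auto simp: dct_mat_def)

lemma dct_mat_first_col_nonzero:
  assumes "j < n"
  shows "dct_mat n $$ (j, 0) \<noteq> 0"
proof -
  have "real j * pi / (2 * real n) < pi / 2"
    using assms by (simp add: field_simps)
  moreover have "0 \<le> real j * pi / (2 * real n)"
    by simp
  ultimately have "cos (real j * pi / (2 * real n)) > 0"
    using pi_gt_zero by (intro cos_gt_zero_pi) linarith+
  then show ?thesis
    using assms by (simp add: dct_mat_def)
qed

lemma det_nonzero_imp_inverse:
  fixes A :: "'a :: field mat"
  assumes "A \<in> carrier_mat n n" and "det A \<noteq> 0"
  obtains B where "B \<in> carrier_mat n n" "A * B = 1\<^sub>m n" "B * A = 1\<^sub>m n"
  using det_non_zero_imp_unit[OF assms, of "()"] that
  by (auto simp: Units_def ring_mat_def)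

lemma mult_one_imp_det_nonzero:
  fixes A B :: "'a :: field mat"
  assumes "A \<in> carrier_mat n n" and "B \<in> carrier_mat n n" and "A * B = 1\<^sub>m n"
  shows "det A \<noteq> 0" "det B \<noteq> 0"
proof -
  have "det A * det B = 1"
    using det_mult[OF assms(1,2)] assms(3) by simp
  then show "det A \<noteq> 0" "det B \<noteq> 0"
    by auto
qed

lemma c_mat_invertible:
  assumes "0 < n"
  shows c_mat_carrier: "c_mat n \<in> carrier_mat n n"
    and det_c_mat_nonzero: "det (c_mat n) \<noteq> 0"
proof -
  let ?w = "\<lambda>j. dct_mat n $$ (j, 0)"
  have W: "dct_W n \<in> carrier_mat n n"
    by (simp add: dct_W_def)
  have "mat_diag n ?w * mat_diag n (\<lambda>j. 1 / ?w j) = 1\<^sub>m n"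
    unfolding mat_diag_diag using dct_mat_first_col_nonzero
    by (auto simp: mat_diag_def intro!: eq_matI)
  then have "det (dct_W n) \<noteq> 0"
    unfolding dct_W_def by (rule mult_one_imp_det_nonzero[rotated 2]) auto
  then obtain V where V: "mat_inverse (dct_W n) = Some V"
    using mat_inverse(1)[OF W, of "()"] det_non_zero_imp_unit[OF W, of "()"] by fastforce
  with mat_inverse(2)[OF W V] W have V': "V \<in> carrier_mat n n" "det V \<noteq> 0"
    using mult_one_imp_det_nonzero(2)[OF W] by auto
  have C: "det (dct_mat n) \<noteq> 0"
    using mult_one_imp_det_nonzero(1)[OF _ _ dct_mat_orthogonal[OF assms]] by simp
  have Z: "1\<^sub>m n + superdiag_mat n \<in> carrier_mat n n"
    by (simp add: superdiag_mat_def)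
  have "upper_triangular (1\<^sub>m n + superdiag_mat n)"
    using Z by (auto simp: superdiag_mat_def)
  moreover have "0 \<notin> set (diag_mat (1\<^sub>m n + superdiag_mat n))"
    by (auto simp: diag_mat_def superdiag_mat_def)
  ultimately have "det (1\<^sub>m n + superdiag_mat n) \<noteq> 0"
    using upper_triangular_imp_det_eq_0_iff[OF Z] by blast
  with C V' show "det (c_mat n) \<noteq> 0"
    unfolding c_mat_def V option.sel
    using det_mult[OF mult_carrier_mat[OF V'(1) dct_mat_carrier] Z]
      det_mult[OF V'(1) dct_mat_carrier] by simp
  show "c_mat n \<in> carrier_mat n n"
    unfolding c_mat_def V option.sel using V'(1) dct_mat_carrier Z by (intro mult_carrier_mat)
qed

section \<open>Tensors and their transformed slices\<close>

text \<open>
  The mode-3 product of the tensor \<open>A\<close> with the matrix \<open>N\<close>. The transform is the case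
  \<open>N = c_mat n3\<close>. The slice dimensions are parameters because they cannot be read off a
  tensor without slices.
\<close>

definition combine_slices :: "complex mat \<Rightarrow> nat \<Rightarrow> nat \<Rightarrow> tensor \<Rightarrow> tensor" where
  "combine_slices N n1 n2 A = vec (dim_row N) (\<lambda>k. mat n1 n2
     (\<lambda>(i, j). \<Sum>l<dim_col N. N $$ (k, l) * A $ l $$ (i, j)))"

lemma carrier_tensorD:
  assumes "A \<in> carrier_tensor n1 n2 n3"
  shows "dim_vec A = n3" and "k < n3 \<Longrightarrow> A $ k \<in> carrier_mat n1 n2"
  using assms by (auto simp: carrier_tensor_def)

lemma carrier_tensor_dims:
  assumes "A \<in> carrier_tensor n1 n2 n3" and "0 < n3"
  shows "tensor_dim1 A = n1" "tensor_dim2 A = n2" "tensor_dim3 A = n3"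
  using assms by (auto simp: carrier_tensor_def tensor_dim1_def tensor_dim2_def tensor_dim3_def)

lemma carrier_tensor_eqI:
  assumes "A \<in> carrier_tensor n1 n2 n3" "B \<in> carrier_tensor n1 n2 n3"
    and "\<And>k. k < n3 \<Longrightarrow> A $ k = B $ k"
  shows "A = B"
  using assms by (intro eq_vecI) (auto simp: carrier_tensor_def)

lemma combine_slices_carrier [simp]:
  "N \<in> carrier_mat m n3 \<Longrightarrow> combine_slices N n1 n2 A \<in> carrier_tensor n1 n2 m"
  unfolding combine_slices_def carrier_tensor_def by simp

lemma combine_slices_inverse:
  assumes N: "N \<in> carrier_mat n3 n3" and M: "M \<in> carrier_mat n3 n3" and "N * M = 1\<^sub>m n3"
    and A: "A \<in> carrier_tensor n1 n2 n3"
  shows "combine_slices N n1 n2 (combine_slices M n1 n2 A) = A"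
proof (rule carrier_tensor_eqI[OF _ A])
  fix k assume k: "k < n3"
  have NM: "(\<Sum>l<n3. N $$ (k, l) * M $$ (l, m)) = (if k = m then 1 else 0)" if "m < n3" for m
  proof -
    have "(N * M) $$ (k, m) = (\<Sum>l<n3. N $$ (k, l) * M $$ (l, m))"
      using N M k that by (simp add: scalar_prod_def lessThan_atLeast0)
    with assms(3) k that show ?thesis by simp
  qed
  show "combine_slices N n1 n2 (combine_slices M n1 n2 A) $ k = A $ k"
  proof (rule eq_matI)
    fix i j assume "i < dim_row (A $ k)" "j < dim_col (A $ k)"
    then have ij: "i < n1" "j < n2"
      using carrier_tensorD(2)[OF A k] by auto
    have "combine_slices N n1 n2 (combine_slices M n1 n2 A) $ k $$ (i, j)
      = (\<Sum>l<n3. N $$ (k, l) * (\<Sum>m<n3. M $$ (l, m) * A $ m $$ (i, j)))"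
      using N M k ij by (simp add: combine_slices_def)
    also have "\<dots> = (\<Sum>m<n3. (\<Sum>l<n3. N $$ (k, l) * M $$ (l, m)) * A $ m $$ (i, j))"
      unfolding sum_distrib_left sum_distrib_right by (subst sum.swap) (simp add: mult.assoc)
    also have "\<dots> = (\<Sum>m<n3. if k = m then A $ m $$ (i, j) else 0)"
      by (intro sum.cong) (auto simp: NM)
    also have "\<dots> = A $ k $$ (i, j)"
      using k by simp
    finally show "combine_slices N n1 n2 (combine_slices M n1 n2 A) $ k $$ (i, j) = A $ k $$ (i, j)" .
  qed (use carrier_tensorD(2)[OF A k] N k in \<open>auto simp: combine_slices_def\<close>)
qed (use N in simp)

lemma c_transform_eq_combine_slices:
  assumes "A \<in> carrier_tensor n1 n2 n3" and "0 < n3"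
  shows "c_transform A = combine_slices (c_mat n3) n1 n2 A"
  using c_mat_carrier[OF assms(2)]
  by (simp add: c_transform_def combine_slices_def carrier_tensor_dims[OF assms])

lemma c_transform_carrier:
  assumes "A \<in> carrier_tensor n1 n2 n3" and "0 < n3"
  shows "c_transform A \<in> carrier_tensor n1 n2 n3"
  unfolding c_transform_eq_combine_slices[OF assms]
  using c_mat_carrier[OF assms(2)] by (rule combine_slices_carrier)

lemma c_transform_slice_carrier:
  assumes "A \<in> carrier_tensor n1 n2 n3" and "k < n3"
  shows "c_transform A $ k \<in> carrier_mat n1 n2"
  using carrier_tensorD(2)[OF c_transform_carrier[OF assms(1)]] assms(2) by simp

lemma tensor_eqI_transform:
  assumes "A \<in> carrier_tensor n1 n2 n3" "B \<in> carrier_tensor n1 n2 n3" and "0 < n3"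
    and "\<And>k. k < n3 \<Longrightarrow> c_transform A $ k = c_transform B $ k"
  shows "A = B"
proof -
  obtain N where N: "N \<in> carrier_mat n3 n3" "N * c_mat n3 = 1\<^sub>m n3"
    using det_nonzero_imp_inverse[OF c_mat_invertible[OF assms(3)]] by blast
  note inverse = combine_slices_inverse[OF N(1) c_mat_carrier[OF assms(3)] N(2)]
  have eq: "c_transform A = c_transform B"
    by (rule carrier_tensor_eqI[OF c_transform_carrier[OF assms(1,3)]
          c_transform_carrier[OF assms(2,3)] assms(4)])
  have "A = combine_slices N n1 n2 (c_transform A)"
    unfolding c_transform_eq_combine_slices[OF assms(1,3)] by (rule inverse[OF assms(1), symmetric])
  also have "\<dots> = B"
    unfolding eq c_transform_eq_combine_slices[OF assms(2,3)] by (rule inverse[OF assms(2)])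
  finally show ?thesis .
qed

text \<open>
  Bijectivity of the transform, in the form that matches the definite descriptions by which the
  tensor operations are given.
\<close>

lemma tensor_of_transformed_slices:
  assumes "0 < n3" and "\<And>k. k < n3 \<Longrightarrow> s k \<in> carrier_mat n1 n2"
  shows "\<exists>!A. A \<in> carrier_tensor n1 n2 n3 \<and> (\<forall>k<n3. c_transform A $ k = s k)"
proof -
  obtain N where N: "N \<in> carrier_mat n3 n3" "c_mat n3 * N = 1\<^sub>m n3"
    using det_nonzero_imp_inverse[OF c_mat_invertible[OF assms(1)]] by blast
  define A where "A = combine_slices N n1 n2 (vec n3 s)"
  have A: "A \<in> carrier_tensor n1 n2 n3"
    using N by (simp add: A_def)
  have "vec n3 s \<in> carrier_tensor n1 n2 n3"
    using assms(2) by (simp add: carrier_tensor_def)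
  then have "c_transform A = vec n3 s"
    using combine_slices_inverse[OF c_mat_carrier[OF assms(1)] N]
    by (simp add: c_transform_eq_combine_slices[OF A assms(1)]) (simp add: A_def)
  then have "\<forall>k<n3. c_transform A $ k = s k"
    by simp
  with A show ?thesis
    by (intro ex1I[of _ A]) (auto intro: tensor_eqI_transform[OF _ _ assms(1)])
qed

lemma c_prod_transform:
  assumes "A \<in> carrier_tensor n1 n2 n3" "B \<in> carrier_tensor n2 m n3" and "0 < n3"
  shows "A *\<^sub>c B \<in> carrier_tensor n1 m n3"
    and "k < n3 \<Longrightarrow> c_transform (A *\<^sub>c B) $ k = c_transform A $ k * c_transform B $ k"
proof -
  have "\<exists>!C. C \<in> carrier_tensor n1 m n3
      \<and> (\<forall>k<n3. c_transform C $ k = c_transform A $ k * c_transform B $ k)"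
    by (rule tensor_of_transformed_slices[OF assms(3)],
      rule mult_carrier_mat[OF c_transform_slice_carrier[OF assms(1)]
        c_transform_slice_carrier[OF assms(2)]])
  from theI'[OF this] show "A *\<^sub>c B \<in> carrier_tensor n1 m n3"
    "k < n3 \<Longrightarrow> c_transform (A *\<^sub>c B) $ k = c_transform A $ k * c_transform B $ k"
    unfolding c_prod_def carrier_tensor_dims[OF assms(1,3)] carrier_tensor_dims[OF assms(2,3)]
    by auto
qed

lemma c_identity_transform:
  assumes "0 < n3"
  shows "c_identity n n3 \<in> carrier_tensor n n n3"
    and "k < n3 \<Longrightarrow> c_transform (c_identity n n3) $ k = 1\<^sub>m n"
  using theI'[OF tensor_of_transformed_slices[OF assms, of "\<lambda>_. 1\<^sub>m n" n n]]
  unfolding c_identity_def by auto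

lemma mat_adjoint_dims [simp]:
  "dim_row (mat_adjoint A) = dim_col A" "dim_col (mat_adjoint A) = dim_row A"
  by (simp_all add: mat_adjoint_def)

lemma mat_adjoint_carrier [simp]:
  "A \<in> carrier_mat m n \<Longrightarrow> mat_adjoint A \<in> carrier_mat n m"
  unfolding carrier_mat_def by simp

lemma c_adjoint_transform:
  assumes "A \<in> carrier_tensor n1 n2 n3" and "0 < n3"
  shows "c_adjoint A \<in> carrier_tensor n2 n1 n3"
    and "k < n3 \<Longrightarrow> c_transform (c_adjoint A) $ k = mat_adjoint (c_transform A $ k)"
proof -
  have "\<exists>!C. C \<in> carrier_tensor n2 n1 n3
      \<and> (\<forall>k<n3. c_transform C $ k = mat_adjoint (c_transform A $ k))"
    by (rule tensor_of_transformed_slices[OF assms(2)],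
      rule mat_adjoint_carrier[OF c_transform_slice_carrier[OF assms(1)]])
  from theI'[OF this] show "c_adjoint A \<in> carrier_tensor n2 n1 n3"
    "k < n3 \<Longrightarrow> c_transform (c_adjoint A) $ k = mat_adjoint (c_transform A $ k)"
    unfolding c_adjoint_def carrier_tensor_dims[OF assms] by auto
qed

section \<open>Full rank complex matrices\<close>

text \<open>
  Conditions on dimensions instead of carriers leave no free variables in the premises, so this
  can serve as a rewrite rule.
\<close>

lemma mult_mat_assoc_dims:
  fixes A B C :: "'a :: semiring_0 mat"
  assumes "dim_col A = dim_row B" and "dim_col B = dim_row C"
  shows "A * B * C = A * (B * C)"
  using assms by (intro assoc_mult_mat[of A "dim_row A" "dim_row B" B "dim_row C" C "dim_col C"]) auto

lemma index_mat_adjoint: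
  assumes "i < dim_col A" and "j < dim_row A"
  shows "mat_adjoint A $$ (i, j) = conjugate (A $$ (j, i))"
  using assms by (simp add: mat_adjoint_def mat_of_rows_index)

lemma mat_adjoint_adjoint [simp]: "mat_adjoint (mat_adjoint A) = A"
  by (rule eq_matI) (simp_all add: index_mat_adjoint)

lemma mat_adjoint_one [simp]: "mat_adjoint (1\<^sub>m n) = (1\<^sub>m n :: complex mat)"
  by (rule eq_matI) (auto simp: index_mat_adjoint)

lemma mat_adjoint_mult:
  fixes A B :: "complex mat"
  assumes "dim_col A = dim_row B"
  shows "mat_adjoint (A * B) = mat_adjoint B * mat_adjoint A"
  using assms
  by (intro eq_matI) (simp_all add: index_mat_adjoint scalar_prod_def mult.commute)

lemma mat_adjoint_scalar_prod:
  fixes A :: "complex mat"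
  assumes A: "A \<in> carrier_mat n m" and v: "v \<in> carrier_vec m" and w: "w \<in> carrier_vec n"
  shows "(mat_adjoint A *\<^sub>v w) \<bullet>c v = w \<bullet>c (A *\<^sub>v v)"
proof -
  have "(mat_adjoint A *\<^sub>v w) \<bullet>c v
      = (\<Sum>i<m. (\<Sum>j<n. cnj (A $$ (j, i)) * w $ j) * cnj (v $ i))"
    using A v w by (simp add: scalar_prod_def index_mat_adjoint lessThan_atLeast0)
  also have "\<dots> = (\<Sum>j<n. w $ j * (\<Sum>i<m. cnj (A $$ (j, i)) * cnj (v $ i)))"
    unfolding sum_distrib_left sum_distrib_right
    by (subst sum.swap) (simp add: ac_simps)
  also have "\<dots> = w \<bullet>c (A *\<^sub>v v)"
    using A v w by (simp add: scalar_prod_def lessThan_atLeast0)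
  finally show ?thesis .
qed

lemma (in vec_space) maximal_lin_indpt_cols:
  obtains S where "maximal S (\<lambda>T. T \<subseteq> set (cols A) \<and> lin_indpt T)"
proof -
  have "lin_indpt {}"
    by (rule finite_lin_indpt2) auto
  then show thesis
    using that maximal_exists_superset[of "set (cols A)"
        "\<lambda>T. T \<subseteq> set (cols A) \<and> lin_indpt T" "{}"] by blast
qed

text \<open>
  The rank is at most the number of different columns, so full rank makes the columns distinct.
  A nontrivial kernel vector is then a nontrivial relation on the set of columns.
\<close>

lemma (in vec_space) full_column_rank_imp_kernel_trivial:
  assumes A: "A \<in> carrier_mat n nc" and "rank A = nc"
    and "v \<in> carrier_vec nc" and "A *\<^sub>v v = 0\<^sub>v n"
  shows "v = 0\<^sub>v nc"
proof -
  obtain S where S: "maximal S (\<lambda>T. T \<subseteq> set (cols A) \<and> lin_indpt T)"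
    using maximal_lin_indpt_cols .
  then have "S \<subseteq> set (cols A)"
    by (simp add: maximal_def)
  then have "nc \<le> card (set (cols A))"
    using rank_card_indpt[OF A S] assms(2) card_mono[of "set (cols A)" S] by simp
  then have "distinct (cols A)"
    using A card_length[of "cols A"] by (intro card_distinct) simp
  then show ?thesis
    using full_rank_lin_indpt[OF A assms(2)] lin_depI[OF A assms(3) _ assms(4)] by blast
qed

text \<open>
  A maximal independent set of columns has \<open>n\<close> elements, hence is a basis of the whole space.
\<close>

lemma (in vec_space) full_row_rank_imp_surjective:
  assumes A: "A \<in> carrier_mat n nc" and "rank A = n" and v: "v \<in> carrier_vec n"
  obtains x where "x \<in> carrier_vec nc" "A *\<^sub>v x = v"
proof -
  have cols: "set (cols A) \<subseteq> carrier_vec n"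
    using A cols_dim by blast
  obtain S where S: "maximal S (\<lambda>T. T \<subseteq> set (cols A) \<and> lin_indpt T)"
    using maximal_lin_indpt_cols .
  then have S': "S \<subseteq> set (cols A)" "lin_indpt S"
    by (simp_all add: maximal_def)
  have "card S = n"
    using rank_card_indpt[OF A S] assms(2) by simp
  moreover have "finite S"
    using S'(1) finite_subset by blast
  ultimately have "basis S"
    using S' cols by (intro dim_li_is_basis) (auto simp: dim_is_n)
  then have "carrier_vec n \<subseteq> span (set (cols A))"
    using span_is_monotone[OF S'(1)] by (simp add: basis_def)
  with v have "v \<in> col_space A"
    by (auto simp: col_space_def)
  then show thesis
    using that A unfolding col_space_eq[OF A] by auto
qed

text \<open>
  If \<open>Q\<^sup>H Q v = 0\<close>, then \<open>Q v\<close> has norm 0, so \<open>v\<close> lies in the kernel of \<open>Q\<close>.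
\<close>

lemma full_column_rank_gram_det_nonzero:
  fixes Q :: "complex mat"
  assumes Q: "Q \<in> carrier_mat n r" and "vec_space.rank n Q = r"
  shows "det (mat_adjoint Q * Q) \<noteq> 0"
proof
  assume "det (mat_adjoint Q * Q) = 0"
  then obtain v where v: "v \<in> carrier_vec r" "v \<noteq> 0\<^sub>v r" "(mat_adjoint Q * Q) *\<^sub>v v = 0\<^sub>v r"
    using det_0_iff_vec_prod_zero_field[OF mult_carrier_mat[OF mat_adjoint_carrier[OF Q] Q]] by blast
  define w where "w = Q *\<^sub>v v"
  have w: "w \<in> carrier_vec n"
    using Q v(1) by (simp add: w_def)
  have "mat_adjoint Q *\<^sub>v w = 0\<^sub>v r"
    using v(3) assoc_mult_mat_vec[OF mat_adjoint_carrier[OF Q] Q v(1)] by (simp add: w_def)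
  then have "w \<bullet>c w = 0"
    using mat_adjoint_scalar_prod[OF Q v(1) w] v(1) by (simp add: w_def[symmetric])
  then have "Q *\<^sub>v v = 0\<^sub>v n"
    using w by (simp add: w_def)
  then show False
    using vec_space.full_column_rank_imp_kernel_trivial[OF Q assms(2) v(1)] v(2) by blast
qed

text \<open>
  As before, \<open>R R\<^sup>H v = 0\<close> forces \<open>R\<^sup>H v = 0\<close>. So \<open>v\<close> is orthogonal to the range of \<open>R\<close>, which is the
  whole space and contains \<open>v\<close> itself.
\<close>

lemma full_row_rank_gram_det_nonzero:
  fixes R :: "complex mat"
  assumes R: "R \<in> carrier_mat r m" and "vec_space.rank r R = r"
  shows "det (R * mat_adjoint R) \<noteq> 0"
proof
  assume "det (R * mat_adjoint R) = 0"
  then obtain v where v: "v \<in> carrier_vec r" "v \<noteq> 0\<^sub>v r" "(R * mat_adjoint R) *\<^sub>v v = 0\<^sub>v r"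
    using det_0_iff_vec_prod_zero_field[OF mult_carrier_mat[OF R mat_adjoint_carrier[OF R]]] by blast
  define u where "u = mat_adjoint R *\<^sub>v v"
  have u: "u \<in> carrier_vec m"
    using mat_adjoint_carrier[OF R] v(1) by (simp add: u_def)
  have "R *\<^sub>v u = 0\<^sub>v r"
    using v(3) assoc_mult_mat_vec[OF R mat_adjoint_carrier[OF R] v(1)] by (simp add: u_def)
  then have "u \<bullet>c u = 0"
    using mat_adjoint_scalar_prod[OF R u v(1)] v(1) by (simp add: u_def[symmetric])
  then have "mat_adjoint R *\<^sub>v v = 0\<^sub>v m"
    using u by (simp add: u_def)
  moreover obtain x where x: "x \<in> carrier_vec m" "R *\<^sub>v x = v"
    using vec_space.full_row_rank_imp_surjective[OF R assms(2) v(1)] .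
  ultimately have "v \<bullet>c v = 0"
    using mat_adjoint_scalar_prod[OF R x(1) v(1)] by simp
  then show False
    using v(1,2) by simp
qed

section \<open>Moore-Penrose inverses of matrices\<close>

definition is_moore_penrose_mat :: "complex mat \<Rightarrow> complex mat \<Rightarrow> bool" where
  "is_moore_penrose_mat A X \<longleftrightarrow> A * X * A = A \<and> X * A * X = X \<and>
     mat_adjoint (A * X) = A * X \<and> mat_adjoint (X * A) = X * A"

text \<open>
  The products \<open>A X\<close> and \<open>A Y\<close> are Hermitian idempotents with the same range, hence equal, and
  likewise \<open>X A\<close> and \<open>Y A\<close>. Then \<open>X = X A X = Y A Y = Y\<close>.
\<close>

lemma moore_penrose_mat_unique:
  assumes A: "A \<in> carrier_mat m n" and X: "X \<in> carrier_mat n m" and Y: "Y \<in> carrier_mat n m"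
    and mpX: "is_moore_penrose_mat A X" and mpY: "is_moore_penrose_mat A Y"
  shows "X = Y"
proof -
  note [simp] = A[THEN carrier_matD(1)] A[THEN carrier_matD(2)] X[THEN carrier_matD(1)]
    X[THEN carrier_matD(2)] Y[THEN carrier_matD(1)] Y[THEN carrier_matD(2)]
  note X_eqs = mpX[unfolded is_moore_penrose_mat_def]
  note Y_eqs = mpY[unfolded is_moore_penrose_mat_def]
  have "A * X = mat_adjoint (A * X)"
    using X_eqs by simp
  also have "\<dots> = mat_adjoint ((A * Y) * (A * X))"
    using Y_eqs by (simp add: mult_mat_assoc_dims[symmetric])
  also have "\<dots> = (A * X) * (A * Y)"
    using X_eqs Y_eqs by (simp add: mat_adjoint_mult[of "A * Y" "A * X"])
  also have "\<dots> = A * Y"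
    using X_eqs by (simp add: mult_mat_assoc_dims[symmetric])
  finally have AX: "A * X = A * Y" .
  have "X * A = mat_adjoint (X * A)"
    using X_eqs by simp
  also have "\<dots> = mat_adjoint ((X * A) * (Y * A))"
    using Y_eqs by (simp add: mult_mat_assoc_dims)
  also have "\<dots> = (Y * A) * (X * A)"
    using X_eqs Y_eqs by (simp add: mat_adjoint_mult[of "X * A" "Y * A"])
  also have "\<dots> = Y * A"
    using X_eqs by (simp add: mult_mat_assoc_dims)
  finally have XA: "X * A = Y * A" .
  have "X = X * A * X"
    using X_eqs by simp
  also have "\<dots> = Y * A * Y"
    using AX by (simp add: XA mult_mat_assoc_dims)
  also have "\<dots> = Y"
    using Y_eqs by simp
  finally show ?thesis .
qed

lemma inverse_of_hermitian_hermitian: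
  fixes H K :: "complex mat"
  assumes H: "H \<in> carrier_mat r r" and K: "K \<in> carrier_mat r r"
    and "mat_adjoint H = H" and "H * K = 1\<^sub>m r"
  shows "mat_adjoint K = K"
proof -
  have "mat_adjoint K * H = 1\<^sub>m r"
    using mat_adjoint_mult[of H K] assms by simp
  then have "K = mat_adjoint K * H * K"
    using K by simp
  also have "\<dots> = mat_adjoint K * (H * K)"
    by (rule assoc_mult_mat[OF mat_adjoint_carrier[OF K] H K])
  also have "\<dots> = mat_adjoint K"
    using assms(4) right_mult_one_mat[OF mat_adjoint_carrier[OF K]] by simp
  finally show ?thesis
    by (rule sym)
qed

text \<open>
  With \<open>G = Q\<^sup>H Q\<close>, \<open>H = R R\<^sup>H\<close> and \<open>E = D\<^sup>H\<close>, the inverse of \<open>R A Q = H E G\<close> is the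
  matrix \<open>Y\<close>. The inverses of the Gram matrices are written as the parts
  \<open>K = E G Y\<close> and \<open>M = Y H E\<close> of the equations \<open>H E G Y = 1\<close> and \<open>Y H E G = 1\<close>; both
  are Hermitian, and this gives \<open>A X = R\<^sup>H K R\<close> and \<open>X A = Q M Q\<^sup>H\<close> for \<open>X = Q Y R\<close>.
\<close>

lemma moore_penrose_mat_of_factorization:
  fixes A Q D R :: "complex mat"
  assumes A: "A \<in> carrier_mat m n" and Q: "Q \<in> carrier_mat n r"
    and D: "D \<in> carrier_mat r r" and R: "R \<in> carrier_mat r m"
    and fac: "mat_adjoint A = Q * D * R" and "det D \<noteq> 0"
    and "det (mat_adjoint Q * Q) \<noteq> 0" and "det (R * mat_adjoint R) \<noteq> 0"
  obtains Y where "Y \<in> carrier_mat r r" "R * A * Q * Y = 1\<^sub>m r" "Y * (R * A * Q) = 1\<^sub>m r"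
    "is_moore_penrose_mat A (Q * Y * R)"
proof -
  define E where "E = mat_adjoint D"
  define G where "G = mat_adjoint Q * Q"
  define H where "H = R * mat_adjoint R"
  have E: "E \<in> carrier_mat r r" and G: "G \<in> carrier_mat r r" and H: "H \<in> carrier_mat r r"
    unfolding E_def G_def H_def
    by (rule mat_adjoint_carrier[OF D] mult_carrier_mat[OF mat_adjoint_carrier[OF Q] Q]
        mult_carrier_mat[OF R mat_adjoint_carrier[OF R]])+
  note [simp] = A[THEN carrier_matD(1)] A[THEN carrier_matD(2)] Q[THEN carrier_matD(1)]
    Q[THEN carrier_matD(2)] D[THEN carrier_matD(1)] D[THEN carrier_matD(2)]
    R[THEN carrier_matD(1)] R[THEN carrier_matD(2)] E[THEN carrier_matD(1)] E[THEN carrier_matD(2)]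
    G[THEN carrier_matD(1)] G[THEN carrier_matD(2)] H[THEN carrier_matD(1)] H[THEN carrier_matD(2)]
  obtain D' where D': "D' \<in> carrier_mat r r" "D * D' = 1\<^sub>m r"
    using det_nonzero_imp_inverse[OF D assms(6)] by blast
  have "mat_adjoint D' * E = 1\<^sub>m r"
    using mat_adjoint_mult[of D D'] D' by (simp add: E_def)
  then have "det E \<noteq> 0"
    using mult_one_imp_det_nonzero(2)[OF mat_adjoint_carrier[OF D'(1)] E] by blast
  then have "det (H * E * G) \<noteq> 0"
    using det_mult[OF mult_carrier_mat[OF H E] G] det_mult[OF H E] assms(7,8)
    by (simp add: G_def H_def)
  then obtain Y where Y: "Y \<in> carrier_mat r r" "H * E * G * Y = 1\<^sub>m r" "Y * (H * E * G) = 1\<^sub>m r"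
    using det_nonzero_imp_inverse[OF mult_carrier_mat[OF mult_carrier_mat[OF H E] G]] by blast
  note [simp] = Y(1)[THEN carrier_matD(1)] Y(1)[THEN carrier_matD(2)]
  have "A = mat_adjoint (Q * D * R)"
    using arg_cong[OF fac, of mat_adjoint] by simp
  then have A_eq: "A = mat_adjoint R * E * mat_adjoint Q"
    by (simp add: mat_adjoint_mult E_def mult_mat_assoc_dims)
  have RAQ: "R * A * Q = H * E * G"
    by (simp add: A_eq H_def G_def mult_mat_assoc_dims)
  define K where "K = E * G * Y"
  define M where "M = Y * H * E"
  have K: "K \<in> carrier_mat r r" and M: "M \<in> carrier_mat r r"
    unfolding K_def M_def using E G H Y(1) by (auto intro!: mult_carrier_mat)
  note [simp] = K[THEN carrier_matD(1)] K[THEN carrier_matD(2)]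
    M[THEN carrier_matD(1)] M[THEN carrier_matD(2)]
  have HK: "H * K = 1\<^sub>m r"
    using Y(2) by (simp add: K_def mult_mat_assoc_dims)
  have MG: "M * G = 1\<^sub>m r"
    using Y(3) by (simp add: M_def mult_mat_assoc_dims)
  have KH: "K * H = 1\<^sub>m r" and GM: "G * M = 1\<^sub>m r"
    using mat_mult_left_right_inverse[OF H K HK] mat_mult_left_right_inverse[OF M G MG] by auto
  have K_herm: "mat_adjoint K = K"
    using inverse_of_hermitian_hermitian[OF H K _ HK] by (simp add: H_def mat_adjoint_mult)
  have M_herm: "mat_adjoint M = M"
    using inverse_of_hermitian_hermitian[OF G M _ GM] by (simp add: G_def mat_adjoint_mult)
  let ?X = "Q * Y * R"
  have AX: "A * ?X = mat_adjoint R * (K * R)"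
    by (simp add: A_eq K_def G_def mult_mat_assoc_dims)
  have XA: "?X * A = Q * (M * mat_adjoint Q)"
    by (simp add: A_eq M_def H_def mult_mat_assoc_dims)
  have "A * ?X * A = mat_adjoint R * (K * H) * E * mat_adjoint Q"
    unfolding AX by (simp add: A_eq H_def mult_mat_assoc_dims)
  then have "A * ?X * A = A"
    using right_mult_one_mat[OF mat_adjoint_carrier[OF R]] by (simp add: KH A_eq)
  moreover have "?X * A * ?X = Q * (M * G) * Y * R"
    unfolding XA by (simp add: G_def mult_mat_assoc_dims)
  then have "?X * A * ?X = ?X"
    using right_mult_one_mat[OF Q] by (simp add: MG)
  moreover have "mat_adjoint (A * ?X) = A * ?X"
    unfolding AX by (simp add: mat_adjoint_mult K_herm mult_mat_assoc_dims)
  moreover have "mat_adjoint (?X * A) = ?X * A"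
    unfolding XA by (simp add: mat_adjoint_mult M_herm mult_mat_assoc_dims)
  ultimately have "is_moore_penrose_mat A ?X"
    unfolding is_moore_penrose_mat_def by blast
  then show thesis
    using that Y unfolding RAQ by blast
qed

section \<open>Tensor inverses are slicewise inverses\<close>

lemma tensor_eq_iff_transform:
  assumes "A \<in> carrier_tensor n1 n2 n3" "B \<in> carrier_tensor n1 n2 n3" and "0 < n3"
  shows "A = B \<longleftrightarrow> (\<forall>k<n3. c_transform A $ k = c_transform B $ k)"
  using tensor_eqI_transform[OF assms] by blast

lemma is_c_inverse_iff_slices:
  assumes B: "B \<in> carrier_tensor n n n3" and "0 < n3"
  shows "is_c_inverse B X \<longleftrightarrow> X \<in> carrier_tensor n n n3 \<and>
    (\<forall>k<n3. c_transform B $ k * c_transform X $ k = 1\<^sub>m n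
          \<and> c_transform X $ k * c_transform B $ k = 1\<^sub>m n)"
proof -
  \<comment> \<open>The size in the definition of an inverse is existentially quantified, but for \<open>n3 > 0\<close> the
    tensor determines it.\<close>
  have dims: "n' = n \<and> n3' = n3" if "B \<in> carrier_tensor n' n' n3'" for n' n3'
    using carrier_tensorD(1)[OF that] carrier_tensorD(1)[OF B] carrier_tensorD(2)[OF that]
      carrier_tensorD(2)[OF B] assms(2) by (metis carrier_matD(1))
  have "is_c_inverse B X \<longleftrightarrow> X \<in> carrier_tensor n n n3 \<and>
      B *\<^sub>c X = c_identity n n3 \<and> X *\<^sub>c B = c_identity n n3"
    unfolding is_c_inverse_def using dims B by blast
  also have "\<dots> \<longleftrightarrow> X \<in> carrier_tensor n n n3 \<and>
    (\<forall>k<n3. c_transform B $ k * c_transform X $ k = 1\<^sub>m n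
          \<and> c_transform X $ k * c_transform B $ k = 1\<^sub>m n)"
  proof (rule conj_cong[OF refl])
    assume X: "X \<in> carrier_tensor n n n3"
    note id = c_identity_transform[OF assms(2), where n = n]
    note BX = c_prod_transform[OF B X assms(2)] and XB = c_prod_transform[OF X B assms(2)]
    show "(B *\<^sub>c X = c_identity n n3 \<and> X *\<^sub>c B = c_identity n n3) \<longleftrightarrow>
      (\<forall>k<n3. c_transform B $ k * c_transform X $ k = 1\<^sub>m n
            \<and> c_transform X $ k * c_transform B $ k = 1\<^sub>m n)"
      unfolding tensor_eq_iff_transform[OF BX(1) id(1) assms(2)]
        tensor_eq_iff_transform[OF XB(1) id(1) assms(2)]
      by (auto simp: id(2) BX(2) XB(2))
  qed
  finally show ?thesis .
qed

text \<open>
  Each of the four equations is an equality of tensors, and equality can be tested on the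
  transformed slices, where the C-product and the conjugate transpose become those of matrices.
\<close>

lemma is_c_moore_penrose_iff_slices:
  assumes A: "A \<in> carrier_tensor n1 n2 n3" and n3: "0 < n3"
  shows "is_c_moore_penrose A X \<longleftrightarrow> X \<in> carrier_tensor n2 n1 n3 \<and>
    (\<forall>k<n3. is_moore_penrose_mat (c_transform A $ k) (c_transform X $ k))"
  unfolding is_c_moore_penrose_def carrier_tensor_dims[OF A n3]
proof (rule conj_cong[OF refl])
  assume X: "X \<in> carrier_tensor n2 n1 n3"
  note AX = c_prod_transform[OF A X n3] and XA = c_prod_transform[OF X A n3]
  note AXA = c_prod_transform[OF AX(1) A n3] and XAX = c_prod_transform[OF XA(1) X n3]
  note AXH = c_adjoint_transform[OF AX(1) n3] and XAH = c_adjoint_transform[OF XA(1) n3]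
  show "(A *\<^sub>c X *\<^sub>c A = A \<and> X *\<^sub>c A *\<^sub>c X = X \<and>
      c_adjoint (A *\<^sub>c X) = A *\<^sub>c X \<and> c_adjoint (X *\<^sub>c A) = X *\<^sub>c A) \<longleftrightarrow>
    (\<forall>k<n3. is_moore_penrose_mat (c_transform A $ k) (c_transform X $ k))"
    unfolding tensor_eq_iff_transform[OF AXA(1) A n3] tensor_eq_iff_transform[OF XAX(1) X n3]
      tensor_eq_iff_transform[OF AXH(1) AX(1) n3] tensor_eq_iff_transform[OF XAH(1) XA(1) n3]
    by (auto simp: is_moore_penrose_mat_def AX(2) XA(2) AXA(2) XAX(2) AXH(2) XAH(2))
qed

lemma c_inverse_eqI:
  assumes B: "B \<in> carrier_tensor n n n3" and "0 < n3" and X: "is_c_inverse B X"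
  shows "c_inverse B = X"
  unfolding c_inverse_def
proof (rule the_equality[where P = "is_c_inverse B", OF X])
  fix Z assume Z: "is_c_inverse B Z"
  note X' = X[unfolded is_c_inverse_iff_slices[OF assms(1,2)]]
  note Z' = Z[unfolded is_c_inverse_iff_slices[OF assms(1,2)]]
  show "Z = X"
  proof (rule tensor_eqI_transform[OF _ _ assms(2)])
    fix k assume k: "k < n3"
    have Bk: "c_transform B $ k \<in> carrier_mat n n" and Xk: "c_transform X $ k \<in> carrier_mat n n"
      and Zk: "c_transform Z $ k \<in> carrier_mat n n"
      using c_transform_slice_carrier[OF _ k] B X'[THEN conjunct1] Z'[THEN conjunct1] by simp_all
    have "c_transform Z $ k = c_transform Z $ k * (c_transform B $ k * c_transform X $ k)"
      using X' k Zk by simp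
    also have "\<dots> = c_transform Z $ k * c_transform B $ k * c_transform X $ k"
      by (rule assoc_mult_mat[OF Zk Bk Xk, symmetric])
    also have "\<dots> = c_transform X $ k"
      using Z' k Xk by simp
    finally show "c_transform Z $ k = c_transform X $ k" .
  qed (use X' Z' in auto)
qed

lemma c_moore_penrose_eqI:
  assumes A: "A \<in> carrier_tensor n1 n2 n3" and "0 < n3" and X: "is_c_moore_penrose A X"
  shows "c_moore_penrose A = X"
  unfolding c_moore_penrose_def
proof (rule the_equality[where P = "is_c_moore_penrose A", OF X])
  fix Z assume Z: "is_c_moore_penrose A Z"
  note X' = X[unfolded is_c_moore_penrose_iff_slices[OF assms(1,2)]]
  note Z' = Z[unfolded is_c_moore_penrose_iff_slices[OF assms(1,2)]]
  show "Z = X"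
  proof (rule tensor_eqI_transform[OF _ _ assms(2)])
    fix k assume k: "k < n3"
    show "c_transform Z $ k = c_transform X $ k"
      using moore_penrose_mat_unique[OF c_transform_slice_carrier[OF A k]
          c_transform_slice_carrier[OF Z'[THEN conjunct1] k]
          c_transform_slice_carrier[OF X'[THEN conjunct1] k]] X' Z' k by simp
  qed (use X' Z' in auto)
qed

section \<open>The Moore-Penrose inverse from a C-QDR decomposition\<close>

theorem theorem3p9:
  fixes n1 n2 n3 r :: nat and A Q D R :: tensor
  assumes "0 < n1" and "0 < n2" and "0 < n3"
    and "A \<in> carrier_tensor n1 n2 n3"
    and "is_C_QDR n2 n1 n3 r (c_adjoint A) Q D R"
  shows "c_invertible (R *\<^sub>c A *\<^sub>c Q) \<and>
    c_moore_penrose A = Q *\<^sub>c c_inverse (R *\<^sub>c A *\<^sub>c Q) *\<^sub>c R"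
proof -
  note n3 = assms(3) and A = assms(4)
  have Q: "Q \<in> carrier_tensor n2 r n3" and D: "D \<in> carrier_tensor r r n3"
    and R: "R \<in> carrier_tensor r n1 n3" and D_inv: "c_invertible D"
    and rank_Q: "\<And>k. k < n3 \<Longrightarrow> vec_space.rank n2 (c_transform Q $ k) = r"
    and rank_R: "\<And>k. k < n3 \<Longrightarrow> vec_space.rank r (c_transform R $ k) = r"
    and fac: "c_adjoint A = Q *\<^sub>c D *\<^sub>c R"
    using assms(5) by (auto simp: is_C_QDR_def)
  note QD = c_prod_transform[OF Q D n3]
  note QDR = c_prod_transform[OF QD(1) R n3]
  note RA = c_prod_transform[OF R A n3]
  note RAQ = c_prod_transform[OF RA(1) Q n3]
  have "\<exists>Y. Y \<in> carrier_mat r r \<and> c_transform (R *\<^sub>c A *\<^sub>c Q) $ k * Y = 1\<^sub>m r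
      \<and> Y * c_transform (R *\<^sub>c A *\<^sub>c Q) $ k = 1\<^sub>m r
      \<and> is_moore_penrose_mat (c_transform A $ k) (c_transform Q $ k * Y * c_transform R $ k)"
    if k: "k < n3" for k
  proof -
    note Ak = c_transform_slice_carrier[OF A k] and Qk = c_transform_slice_carrier[OF Q k]
      and Dk = c_transform_slice_carrier[OF D k] and Rk = c_transform_slice_carrier[OF R k]
    obtain D' where "is_c_inverse D D'"
      using D_inv unfolding c_invertible_def by blast
    then have D': "D' \<in> carrier_tensor r r n3" "c_transform D $ k * c_transform D' $ k = 1\<^sub>m r"
      using is_c_inverse_iff_slices[OF D n3] k by auto
    have "det (c_transform D $ k) \<noteq> 0"
      using mult_one_imp_det_nonzero(1)[OF Dk c_transform_slice_carrier[OF D'(1) k] D'(2)] .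
    moreover have "mat_adjoint (c_transform A $ k)
        = c_transform Q $ k * c_transform D $ k * c_transform R $ k"
      using c_adjoint_transform(2)[OF A n3 k] fac QD(2)[OF k] QDR(2)[OF k] by simp
    ultimately obtain Y where "Y \<in> carrier_mat r r"
      "c_transform R $ k * c_transform A $ k * c_transform Q $ k * Y = 1\<^sub>m r"
      "Y * (c_transform R $ k * c_transform A $ k * c_transform Q $ k) = 1\<^sub>m r"
      "is_moore_penrose_mat (c_transform A $ k) (c_transform Q $ k * Y * c_transform R $ k)"
      using moore_penrose_mat_of_factorization[OF Ak Qk Dk Rk _ _
          full_column_rank_gram_det_nonzero[OF Qk rank_Q[OF k]]
          full_row_rank_gram_det_nonzero[OF Rk rank_R[OF k]]] by blast
    then show ?thesis
      unfolding RAQ(2)[OF k] RA(2)[OF k] by blast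
  qed
  then obtain y where y: "\<And>k. k < n3 \<Longrightarrow> y k \<in> carrier_mat r r
      \<and> c_transform (R *\<^sub>c A *\<^sub>c Q) $ k * y k = 1\<^sub>m r
      \<and> y k * c_transform (R *\<^sub>c A *\<^sub>c Q) $ k = 1\<^sub>m r
      \<and> is_moore_penrose_mat (c_transform A $ k) (c_transform Q $ k * y k * c_transform R $ k)"
    by metis
  then obtain Y where Y: "Y \<in> carrier_tensor r r n3" "\<And>k. k < n3 \<Longrightarrow> c_transform Y $ k = y k"
    using tensor_of_transformed_slices[OF n3, of y r r] by blast
  have inv: "is_c_inverse (R *\<^sub>c A *\<^sub>c Q) Y"
    using y Y by (simp add: is_c_inverse_iff_slices[OF RAQ(1) n3])
  note QY = c_prod_transform[OF Q Y(1) n3]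
  note QYR = c_prod_transform[OF QY(1) R n3]
  have "is_c_moore_penrose A (Q *\<^sub>c Y *\<^sub>c R)"
    using y Y(2) by (simp add: is_c_moore_penrose_iff_slices[OF A n3] QYR QY(2))
  then show ?thesis
    using inv c_inverse_eqI[OF RAQ(1) n3 inv] c_moore_penrose_eqI[OF A n3]
    by (auto simp: c_invertible_def)
qed

end
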